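(* $g(Fano)=8$.
   Context: $Fano$ is the simple game on players $[7]$ whose minimal winning coalitions are the seven lines of the Fano plane $\{1,2,3\},\{3,4,5\},\{1,5,6\},\{1,4,7\},\{2,5,7\},\{3,6,7\},\{2,4,6\}$; a coalition is winning iff it contains one of these, otherwise losing. A trading transform of length $j$ is $(X_1,\dots,X_j;Y_1,\dots,Y_j)$, sequences of coalitions such that every player belongs to equally many $X_i$'s as $Y_i$'s; it is a certificate of non-weightedness if all $X_i$ are winning and all $Y_i$ losing, and it is potent if moreover the grand coalition $[7]$ is among the $X_i$ and $\emptyset$ is among the $Y_i$. For a game $G$, $g(G)$ is the length of the shortest potent certificate of non-weightedness for $G$ ($g(G)=\infty$ if $G$ is roughly weighted). *)

theory Defs
  imports Complex_Main "HOL-Library.Extended_Nat"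
begin

record 'a game =
  players :: "'a set"
  winning :: "'a set set"

definition simple_game :: "'a game \<Rightarrow> bool" where
  "simple_game G \<longleftrightarrow> finite (players G) \<and> winning G \<subseteq> Pow (players G) \<and> winning G \<noteq> {} \<and>
     (\<forall>X Y. X \<in> winning G \<longrightarrow> X \<subseteq> Y \<longrightarrow> Y \<subseteq> players G \<longrightarrow> Y \<in> winning G)"

definition losing :: "'a game \<Rightarrow> 'a set set" where
  "losing G = Pow (players G) - winning G"

definition minimal_winning :: "'a game \<Rightarrow> 'a set set" where
  "minimal_winning G = {X \<in> winning G. \<forall>Y. Y \<subset> X \<longrightarrow> Y \<notin> winning G}"

definition trading_transform :: "'a game \<Rightarrow> nat \<Rightarrow> 'a set list \<Rightarrow> 'a set list \<Rightarrow> bool" where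
  "trading_transform G j Xs Ys \<longleftrightarrow>
     length Xs = j \<and> length Ys = j \<and> set Xs \<subseteq> Pow (players G) \<and> set Ys \<subseteq> Pow (players G) \<and>
     (\<forall>p \<in> players G. card {i. i < j \<and> p \<in> Xs ! i} = card {i. i < j \<and> p \<in> Ys ! i})"

definition certificate :: "'a game \<Rightarrow> nat \<Rightarrow> 'a set list \<Rightarrow> 'a set list \<Rightarrow> bool" where
  "certificate G j Xs Ys \<longleftrightarrow>
     trading_transform G j Xs Ys \<and> set Xs \<subseteq> winning G \<and> set Ys \<subseteq> losing G"

definition potent_certificate :: "'a game \<Rightarrow> nat \<Rightarrow> 'a set list \<Rightarrow> 'a set list \<Rightarrow> bool" where
  "potent_certificate G j Xs Ys \<longleftrightarrow>
     certificate G j Xs Ys \<and> players G \<in> set Xs \<and> {} \<in> set Ys"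

text \<open>Nonnegative weights and a quota, not all zero; coalitions whose weight equals the quota
  are unconstrained.\<close>

definition roughly_weighted :: "'a game \<Rightarrow> bool" where
  "roughly_weighted G \<longleftrightarrow>
     (\<exists>(w :: 'a \<Rightarrow> real) (q :: real).
        (\<forall>p \<in> players G. 0 \<le> w p) \<and>
        (q \<noteq> 0 \<or> (\<exists>p \<in> players G. w p \<noteq> 0)) \<and>
        (\<forall>X. X \<subseteq> players G \<longrightarrow>
           (sum w X < q \<longrightarrow> X \<in> losing G) \<and> (sum w X > q \<longrightarrow> X \<in> winning G)))"

definition g_number :: "'a game \<Rightarrow> enat" where
  "g_number G =
     (if roughly_weighted G then \<infinity>
      else Inf {enat j | j. \<exists>Xs Ys. potent_certificate G j Xs Ys})"

definition Fano_lines :: "nat set set" where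
  "Fano_lines = {{1,2,3}, {3,4,5}, {1,5,6}, {1,4,7}, {2,5,7}, {3,6,7}, {2,4,6}}"

definition Fano :: "nat game" where
  "Fano = \<lparr>players = {1..7},
           winning = {X. X \<subseteq> {1..7} \<and> (\<exists>L \<in> Fano_lines. L \<subseteq> X)}\<rparr>"

lemma simple_game_Fano: "simple_game Fano"
proof -
  have "{1..7} \<in> winning Fano"
    by (auto simp: Fano_def Fano_lines_def)
  then show ?thesis
    by (auto simp: simple_game_def Fano_def) blast
qed

lemma minimal_winning_Fano: "minimal_winning Fano = Fano_lines"
proof -
  have card3: "card L = 3" if "L \<in> Fano_lines" for L
    using that by (auto simp: Fano_lines_def)
  have fin: "finite L" if "L \<in> Fano_lines" for L
    using that by (auto simp: Fano_lines_def)
  have sub: "L \<subseteq> {1..7}" if "L \<in> Fano_lines" for L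
    using that by (auto simp: Fano_lines_def)
  have anti: "\<not> L \<subset> M" if "L \<in> Fano_lines" "M \<in> Fano_lines" for L M
    using psubset_card_mono[of M L] card3 fin that by fastforce
  show ?thesis
  proof (intro equalityI subsetI)
    fix X assume X: "X \<in> minimal_winning Fano"
    then obtain L where L: "L \<in> Fano_lines" "L \<subseteq> X"
      by (auto simp: minimal_winning_def Fano_def)
    then have "L \<in> winning Fano"
      using sub by (auto simp: Fano_def)
    with X L have "L = X"
      by (auto simp: minimal_winning_def)
    with L show "X \<in> Fano_lines" by simp
  next
    fix X assume X: "X \<in> Fano_lines"
    then have "X \<in> winning Fano"
      using sub by (auto simp: Fano_def)
    moreover have "Y \<notin> winning Fano" if "Y \<subset> X" for Y
      using anti[OF _ X] that by (auto simp: Fano_def)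
    ultimately show "X \<in> minimal_winning Fano"
      by (auto simp: minimal_winning_def)
  qed
qed

end

theory Submission imports Defs
begin

text \<open>
  Every point of the Fano plane lies on three of the seven lines, so averaging over the lines shows
  that a losing coalition has at most four players, while a winning one has at least three.
  Counting players with multiplicity, a potent certificate of length \<open>j\<close> therefore has
  \<open>7 + 3 (j - 1) \<le> 4 (j - 1)\<close>, that is \<open>j \<ge> 8\<close>. Equality is attained by the grand coalition and the
  lines against the empty coalition and the complements of the lines. The same two families, summed
  with weights, show that the game is not roughly weighted.
\<close>

lemma atLeastAtMost_1_7: "{1..7} = {1, 2, 3, 4, 5, 6, 7::nat}"
  by auto

lemma players_Fano: "players Fano = {1..7}"
  by (simp add: Fano_def)

text \<open>Listed as separate facts so that \<open>THEN\<close> instantiates a rule at all seven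
  lines at once.\<close>

lemma Fano_linesI:
  "{1,2,3} \<in> Fano_lines" "{3,4,5} \<in> Fano_lines" "{1,5,6} \<in> Fano_lines"
  "{1,4,7} \<in> Fano_lines" "{2,5,7} \<in> Fano_lines" "{3,6,7} \<in> Fano_lines"
  "{2,4,6} \<in> Fano_lines"
  unfolding Fano_lines_def by (rule insertI1 | rule insertI2)+

text \<open>Double counting: both sides count the incidences of a player with a position, and a
  trading transform balances these player by player.\<close>

lemma trading_transform_sum_card:
  assumes "trading_transform G j Xs Ys" "finite (players G)"
  shows "(\<Sum>i<j. card (Xs ! i)) = (\<Sum>i<j. card (Ys ! i))"
proof -
  have count: "(\<Sum>i<j. card (Zs ! i)) = (\<Sum>p\<in>players G. card {i. i < j \<and> p \<in> Zs ! i})"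
    if Zs: "length Zs = j" "set Zs \<subseteq> Pow (players G)" for Zs
  proof -
    have "card (Zs ! i) = card {p \<in> players G. p \<in> Zs ! i}" if "i < j" for i
    proof -
      have "Zs ! i \<subseteq> players G"
        using Zs that by (metis PowD nth_mem subsetD)
      then show ?thesis by (auto intro: arg_cong[where f = card])
    qed
    then have "(\<Sum>i<j. card (Zs ! i)) = (\<Sum>i<j. card {p \<in> players G. p \<in> Zs ! i})"
      by simp
    also have "\<dots> = (\<Sum>p\<in>players G. card {i \<in> {..<j}. p \<in> Zs ! i})"
      by (rule sum_multicount_gen) (use assms(2) in auto)
    finally show ?thesis by simp
  qed
  show ?thesis
    using assms(1) by (simp add: trading_transform_def count)
qed

lemma card_winning_Fano:
  assumes "X \<in> winning Fano"
  shows "3 \<le> card X"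
proof -
  from assms obtain L where L: "L \<in> Fano_lines" "L \<subseteq> X" and X: "X \<subseteq> {1..7}"
    by (auto simp: Fano_def)
  from L(1) have "card L = 3"
    by (auto simp: Fano_lines_def)
  with card_mono[OF finite_subset[OF X] L(2)] show ?thesis by simp
qed

lemma card_losing_Fano:
  assumes "X \<in> losing Fano"
  shows "card X \<le> 4"
proof -
  from assms have X: "X \<subseteq> {1..7}" and no_line: "\<And>L. L \<in> Fano_lines \<Longrightarrow> \<not> L \<subseteq> X"
    by (auto simp: losing_def Fano_def)
  define x where "x p = (of_bool (p \<in> X) :: nat)" for p
  have line: "x a + x b + x c \<le> 2" if "{a, b, c} \<in> Fano_lines" for a b c
    using no_line[OF that] by (auto simp: x_def)
  have "card X = (\<Sum>p\<in>{1..7}. x p)"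
    using X by (simp add: x_def Int_absorb1 sum.inter_restrict[symmetric] flip: card_eq_sum)
  also have "\<dots> = x 1 + x 2 + x 3 + x 4 + x 5 + x 6 + x 7"
    unfolding atLeastAtMost_1_7 by simp
  \<comment> \<open>Adding the seven instances of \<open>line\<close> counts each point three times,
    so \<open>3 * card X \<le> 14\<close>, which excludes \<open>card X = 5\<close> or more.\<close>
  finally show ?thesis
    using Fano_linesI[THEN line] by linarith
qed

text \<open>Any two lines of a projective plane meet, so the complement of a line contains no
  line.\<close>

lemma Compl_line_losing_Fano:
  assumes "L \<in> Fano_lines"
  shows "{1..7} - L \<in> losing Fano"
proof -
  have "L \<inter> M \<noteq> {}" if "M \<in> Fano_lines" for M
    using assms that unfolding Fano_lines_def by (elim insertE emptyE; simp)
  then show ?thesis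
    by (auto simp: losing_def Fano_def)
qed

lemma line_winning_Fano: "L \<in> Fano_lines \<Longrightarrow> L \<in> winning Fano"
  by (auto simp: Fano_def Fano_lines_def)

lemma not_roughly_weighted_Fano: "\<not> roughly_weighted Fano"
proof
  assume "roughly_weighted Fano"
  then obtain w :: "nat \<Rightarrow> real" and q where nonneg: "\<forall>p\<in>{1..7}. 0 \<le> w p"
    and nonzero: "q \<noteq> 0 \<or> (\<exists>p\<in>{1..7}. w p \<noteq> 0)"
    and sep: "\<forall>X. X \<subseteq> {1..7} \<longrightarrow>
      (sum w X < q \<longrightarrow> X \<in> losing Fano) \<and> (sum w X > q \<longrightarrow> X \<in> winning Fano)"
    unfolding roughly_weighted_def players_Fano by (elim exE conjE) (rule that)
  have bounds: "q \<le> sum w L \<and> sum w {1..7} - sum w L \<le> q" if "L \<in> Fano_lines" for L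
  proof -
    have L: "L \<subseteq> {1..7}"
      using line_winning_Fano[OF that] by (auto simp: Fano_def)
    have "q \<le> sum w L"
      using sep[rule_format, OF L] line_winning_Fano[OF that]
      by (auto simp: losing_def not_less[symmetric])
    moreover have "sum w ({1..7} - L) \<le> q"
      using sep[rule_format, of "{1..7} - L"] Compl_line_losing_Fano[OF that]
      by (auto simp: losing_def not_less[symmetric])
    ultimately show ?thesis
      using L by (simp add: sum_diff)
  qed
  have W: "sum w {1..7} = w 1 + w 2 + w 3 + w 4 + w 5 + w 6 + w 7"
    unfolding atLeastAtMost_1_7 by simp
  have lines: "q \<le> w 1 + w 2 + w 3" "q \<le> w 3 + w 4 + w 5" "q \<le> w 1 + w 5 + w 6"
    "q \<le> w 1 + w 4 + w 7" "q \<le> w 2 + w 5 + w 7" "q \<le> w 3 + w 6 + w 7"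
    "q \<le> w 2 + w 4 + w 6"
    using Fano_linesI[THEN bounds, THEN conjunct1] by simp_all
  have compls: "w 4 + w 5 + w 6 + w 7 \<le> q" "w 1 + w 2 + w 6 + w 7 \<le> q"
    "w 2 + w 3 + w 4 + w 7 \<le> q" "w 2 + w 3 + w 5 + w 6 \<le> q"
    "w 1 + w 3 + w 4 + w 6 \<le> q" "w 1 + w 2 + w 4 + w 5 \<le> q"
    "w 1 + w 3 + w 5 + w 7 \<le> q"
    using Fano_linesI[THEN bounds, THEN conjunct2] unfolding W by simp_all
  have "0 \<le> sum w {1..7}"
    using nonneg by (intro sum_nonneg) auto
  \<comment> \<open>Let \<open>W\<close> be the total weight. Each point lies on three lines and in
    four complements, so summing \<open>lines\<close> and \<open>compls\<close> gives
    \<open>7 * q \<le> 3 * W\<close> and \<open>4 * W \<le> 7 * q\<close>. With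
    \<open>0 \<le> W\<close> this forces both to vanish.\<close>
  then have "sum w {1..7} = 0" "q = 0"
    using lines compls unfolding W by linarith+
  moreover from this(1) have "\<forall>p\<in>{1..7}. w p = 0"
    using nonneg by (subst (asm) sum_nonneg_eq_0_iff) auto
  ultimately show False
    using nonzero by auto
qed

lemma potent_certificate_Fano_ge:
  assumes "potent_certificate Fano j Xs Ys"
  shows "8 \<le> j"
proof -
  have tt: "trading_transform Fano j Xs Ys"
    and win: "set Xs \<subseteq> winning Fano" and lose: "set Ys \<subseteq> losing Fano"
    and full: "{1..7} \<in> set Xs" and empty: "{} \<in> set Ys"
    using assms by (auto simp: potent_certificate_def certificate_def Fano_def)
  have len: "length Xs = j" "length Ys = j"
    using tt by (auto simp: trading_transform_def)
  obtain a b where a: "a < j" "Xs ! a = {1..7}" and b: "b < j" "Ys ! b = {}"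
    using full empty len by (metis in_set_conv_nth)
  \<comment> \<open>One position is reserved for the grand coalition, and below one for the empty
    one. As \<open>a < j\<close> makes \<open>j\<close> positive, \<open>j - 1\<close> is not
    truncated.\<close>
  have "7 + 3 * (j - 1) = (\<Sum>i<j. if i = a then 7 else 3::nat)"
    using a by (simp add: sum.remove[of _ a])
  also have "\<dots> \<le> (\<Sum>i<j. card (Xs ! i))"
    by (rule sum_mono) (use a win len nth_mem in \<open>auto intro!: card_winning_Fano\<close>)
  also have "\<dots> = (\<Sum>i<j. card (Ys ! i))"
    by (rule trading_transform_sum_card[OF tt]) (simp add: Fano_def)
  also have "\<dots> \<le> (\<Sum>i<j. if i = b then 0 else 4::nat)"
    by (rule sum_mono) (use b lose len nth_mem in \<open>auto intro!: card_losing_Fano\<close>)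
  also have "\<dots> = 4 * (j - 1)"
    using b by (simp add: sum.remove[of _ b])
  finally show ?thesis by simp
qed

lemma potent_certificate_Fano_8: "\<exists>Xs Ys. potent_certificate Fano 8 Xs Ys"
proof -
  define Ls :: "nat set list"
    where "Ls = [{1,2,3}, {3,4,5}, {1,5,6}, {1,4,7}, {2,5,7}, {3,6,7}, {2,4,6}]"
  define Xs where "Xs = {1..7} # Ls"
  define Ys where "Ys = {} # map (\<lambda>L. {1..7} - L) Ls"
  have set_Ls: "set Ls = Fano_lines"
    by (simp add: Ls_def Fano_lines_def)
  have len: "length Xs = 8" "length Ys = 8"
    by (simp_all add: Xs_def Ys_def Ls_def)
  have win: "set Xs \<subseteq> winning Fano"
    using line_winning_Fano by (auto simp: Xs_def set_Ls) (auto simp: Fano_def Fano_lines_def)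
  have lose: "set Ys \<subseteq> losing Fano"
    using Compl_line_losing_Fano
    by (auto simp: Ys_def set_Ls) (auto simp: losing_def Fano_def Fano_lines_def)
  \<comment> \<open>Both counts are 4: three lines and the grand coalition on one side, four
    complements of lines on the other. Rewriting them as lengths of filtered lists lets
    simplification evaluate them for each player.\<close>
  have "card {i. i < 8 \<and> p \<in> Xs ! i} = card {i. i < 8 \<and> p \<in> Ys ! i}" if "p \<in> {1..7}" for p
  proof -
    have count: "card {i. i < 8 \<and> p \<in> Zs ! i} = length (filter (\<lambda>Z. p \<in> Z) Zs)"
      if "length Zs = 8" for Zs
      using that by (simp add: length_filter_conv_card)
    show ?thesis
      using \<open>p \<in> {1..7}\<close> unfolding count[OF len(1)] count[OF len(2)]
      unfolding Xs_def Ys_def Ls_def atLeastAtMost_1_7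
      by auto
  qed
  moreover have "set Xs \<subseteq> Pow {1..7}" "set Ys \<subseteq> Pow {1..7}"
    using win lose by (auto simp: losing_def Fano_def)
  ultimately have "potent_certificate Fano 8 Xs Ys"
    using win lose len
    unfolding potent_certificate_def certificate_def trading_transform_def
    by (simp add: Fano_def) (simp add: Xs_def Ys_def)
  then show ?thesis by blast
qed

theorem theorem10: "g_number Fano = 8"
proof -
  have "Inf {enat j | j. \<exists>Xs Ys. potent_certificate Fano j Xs Ys} = enat 8"
  proof (rule antisym)
    show "Inf {enat j | j. \<exists>Xs Ys. potent_certificate Fano j Xs Ys} \<le> enat 8"
      using potent_certificate_Fano_8 by (intro Inf_lower) blast
    show "enat 8 \<le> Inf {enat j | j. \<exists>Xs Ys. potent_certificate Fano j Xs Ys}"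
      by (rule Inf_greatest) (auto dest: potent_certificate_Fano_ge)
  qed
  then show ?thesis
    using not_roughly_weighted_Fano by (simp add: g_number_def numeral_eq_enat)
qed

end
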